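(* (i) Let $A \subseteq \mathbb{N}$ have property $P$. Then $A$ has natural density $0$; equivalently, if $A = \{a_1 < a_2 < \dots\}$ is infinite, then $a_j/j \to \infty$ as $j \to \infty$. (ii) Conversely, for any function $f\colon \mathbb{N} \to \mathbb{N}$ with $f(j) \to \infty$ as $j \to \infty$, there exists an infinite strictly increasing sequence $A = \{a_1 < a_2 < \dots\}$ of natural numbers with property $P$ such that $a_j/j \le f(j)$ for all $j \in \mathbb{N}$.
   Context: $\mathrm{SF}$ denotes the set of squarefree positive integers, i.e. $\mathbb{N}$ minus all positive multiples of $p^2$ for primes $p$. A set $A \subseteq \mathbb{N}$ has property $P$ if for every $n \in \mathbb{N}$ there are only finitely many $a \in A$ with $n + a \in \mathrm{SF}$. For $x>0$, $[x] = \{n \in \mathbb{N} : n \le x\}$. The natural density of $A$ is $\lim_{x\to\infty} |A \cap [x]|/x$ when this limit exists. *)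

theory Defs
  imports Complex_Main "HOL-Computational_Algebra.Squarefree" "HOL-Library.Infinite_Set"
begin

text \<open>The natural numbers of the paper are the positive integers; they are rendered as the
  subset \<open>{1..}\<close> of the type \<^typ>\<open>nat\<close>.\<close>

definition SF :: "nat set" where
  "SF = {n \<in> {1..}. squarefree n}"

definition property_P :: "nat set \<Rightarrow> bool" where
  "property_P A \<longleftrightarrow> (\<forall>n\<ge>1. finite {a \<in> A. n + a \<in> SF})"

definition initial_segment :: "real \<Rightarrow> nat set" where
  "initial_segment x = {n \<in> {1..}. real n \<le> x}"

definition has_natural_density :: "nat set \<Rightarrow> real \<Rightarrow> bool" where
  "has_natural_density A d \<longleftrightarrow>
     ((\<lambda>x::real. real (card (A \<inter> initial_segment x)) / x) \<longlongrightarrow> d) at_top"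

text \<open>For infinite \<open>A = {a\<^sub>1 < a\<^sub>2 < \<dots>}\<close>, \<open>nth_element A j\<close> is \<open>a\<^sub>j\<close>. Indices start at 1, whereas
  \<^const>\<open>enumerate\<close> counts from 0; the value at \<open>j = 0\<close> is meaningless.\<close>

definition nth_element :: "nat set \<Rightarrow> nat \<Rightarrow> nat" where
  "nth_element A j = enumerate A (j - 1)"

end

theory Submission
  imports Defs "HOL-Number_Theory.Cong" "HOL-Real_Asymp.Real_Asymp"
begin

text \<open>
  (i) Put \<open>W = y!\<close>. Every \<open>a\<close> is at distance at most \<open>W + 1\<close> below some \<open>m \<equiv> 1 (mod W)\<close>. By
  property P, for all but finitely many \<open>a \<in> A\<close> this \<open>m\<close> is not squarefree; being coprime to all
  primes up to \<open>y\<close>, it is divisible by \<open>p\<^sup>2\<close> for some prime \<open>p > y\<close>. The proportion of such \<open>m\<close> is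
  at most \<open>\<Sum>\<^bsub>d>y\<^esub> 1/d\<^sup>2 \<le> 1/y\<close>, so the upper density of \<open>A\<close> is at most \<open>1/y\<close>, for every \<open>y\<close>.

  (ii) If \<open>q\<^sub>1, q\<^sub>2, \<dots>\<close> are distinct primes, the \<open>a\<close> with \<open>q\<^sub>n\<^sup>2 dvd n + a\<close> for all \<open>n \<le> k\<close> form a
  residue class modulo \<open>M k = q\<^sub>1\<^sup>2 \<cdots> q\<^sub>k\<^sup>2\<close>. Choose \<open>a\<^sub>j\<close> greedily in such a class with \<open>k = g j\<close>, where
  \<open>g\<close> tends to infinity so slowly that \<open>M (g j) \<le> f i\<close> for all \<open>i \<ge> j\<close>.
\<close>

section \<open>Non-squarefree terms of the progression \<open>k * W + 1\<close>\<close>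

text \<open>A divisor \<open>d\<close> of some \<open>k * W + 1\<close> is coprime to
  \<open>W\<close>, so the admissible \<open>k\<close> all lie in one residue class modulo
  \<open>d\<close>. Hence \<open>k div d\<close> determines \<open>k\<close>.\<close>

lemma card_dvd_progression:
  fixes d W K :: nat
  assumes "d > 0"
  shows "card {k\<in>{1..K}. d dvd k * W + 1} \<le> K div d + 1"
proof -
  let ?S = "{k\<in>{1..K}. d dvd k * W + 1}"
  have "inj_on (\<lambda>k. k div d) ?S"
  proof (rule inj_onI)
    fix k l assume k: "k \<in> ?S" and l: "l \<in> ?S" and kl: "k div d = l div d"
    have "coprime d W"
    proof (rule coprimeI)
      fix c assume "c dvd d" "c dvd W"
      with k have "c dvd k * W + 1" "c dvd k * W" by auto
      then show "is_unit c" by (metis dvd_add_right_iff)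
    qed
    moreover have "[k * W = l * W] (mod d)"
    proof -
      have "[k * W + 1 = 0] (mod d)" "[l * W + 1 = 0] (mod d)"
        using k l by (auto simp: cong_0_iff)
      then have "[k * W + 1 = l * W + 1] (mod d)" by (meson cong_sym cong_trans)
      then show ?thesis by (simp only: cong_add_rcancel_nat)
    qed
    ultimately have "[k = l] (mod d)"
      by (simp add: cong_mult_rcancel_nat coprime_commute)
    then have "k mod d = l mod d" by (simp only: unique_euclidean_semiring_class.cong_def)
    with kl have "k div d * d + k mod d = l div d * d + l mod d" by (simp only:)
    then show "k = l" by (simp only: div_mult_mod_eq)
  qed
  moreover have "(\<lambda>k. k div d) ` ?S \<subseteq> {0..K div d}"
    by (auto intro: div_le_mono)
  ultimately have "card ?S \<le> card {0..K div d}"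
    by (intro card_inj_on_le) auto
  then show ?thesis by simp
qed

text \<open>Telescoping: \<open>1/d^2 \<le> 1/(d - 1) - 1/d\<close>. The induction keeps the
  subtracted last term, which is dropped only at the end.\<close>

lemma sum_inverse_squares_tail:
  fixes y L :: nat
  assumes "y \<ge> 1"
  shows "(\<Sum>d\<in>{y<..L}. 1 / real d ^ 2) \<le> 1 / real y"
proof -
  have "(\<Sum>d\<in>{y<..y + m}. 1 / real d ^ 2) \<le> 1 / real y - 1 / real (y + m)" for m
  proof (induction m)
    case (Suc m)
    have "{y<..y + Suc m} = insert (y + Suc m) {y<..y + m}" by auto
    then have "(\<Sum>d\<in>{y<..y + Suc m}. 1 / real d ^ 2)
        \<le> 1 / real (y + Suc m) ^ 2 + (1 / real y - 1 / real (y + m))"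
      using Suc by simp
    also have "1 / real (y + Suc m) ^ 2 \<le> 1 / (real (y + m) * real (y + Suc m))"
      using assms unfolding power2_eq_square
      by (intro divide_left_mono mult_right_mono mult_pos_pos) auto
    also have "1 / (real (y + m) * real (y + Suc m)) = 1 / real (y + m) - 1 / real (y + Suc m)"
      using assms by (simp add: field_simps)
    finally show ?case by simp
  qed simp
  note bound = this
  show ?thesis
  proof (cases "L \<le> y")
    case False
    have "(\<Sum>d\<in>{y<..y + (L - y)}. 1 / real d ^ 2) \<le> 1 / real y - 1 / real (y + (L - y))"
      by (rule bound)
    also have "\<dots> \<le> 1 / real y" by simp
    finally show ?thesis using False by simp
  qed simp
qed

text \<open>Every prime up to \<open>y\<close> divides \<open>fact y\<close>, hence not
  \<open>k * fact y + 1\<close>. Only the size of \<open>p\<close> is exported, since the union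
  bound to follow runs over all integers above \<open>y\<close>.\<close>

lemma prime_square_dvd_fact_progression:
  fixes k y :: nat
  assumes "\<not> squarefree (k * fact y + 1)"
  obtains p where "p > y" "p ^ 2 dvd k * fact y + 1"
proof -
  obtain p :: nat where p: "prime p" "p ^ 2 dvd k * fact y + 1"
    using assms squarefree_factorial_semiring[of "k * fact y + 1 :: nat"] by auto
  have "p > y"
  proof (rule ccontr)
    assume "\<not> p > y"
    then have "p dvd k * fact y"
      using p(1) by (simp add: prime_dvd_fact_iff)
    moreover have "p dvd k * fact y + 1"
      using p(2) by (meson dvd_trans dvd_power zero_less_numeral)
    ultimately have "p dvd 1" by (metis dvd_add_right_iff)
    then show False using p(1) by simp
  qed
  with p that show ?thesis by blast
qed

text \<open>Union bound over \<open>d > y\<close>. No term exceeds \<open>X\<close>, the one with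
  \<open>k = K\<close>, so \<open>d \<le> sqrt X\<close>; the error \<open>+ 1\<close> made for each
  \<open>d\<close> therefore adds up to at most \<open>sqrt X\<close>.\<close>

lemma card_nonsquarefree_progression:
  fixes y K :: nat
  assumes "y \<ge> 1"
  shows "real (card {k\<in>{1..K}. \<not> squarefree (k * fact y + 1)})
    \<le> real K / real y + sqrt (real (K * fact y + 1))"
proof -
  define X :: nat where "X = K * fact y + 1"
  define L where "L = nat \<lfloor>sqrt (real X)\<rfloor>"
  let ?S = "{k\<in>{1..K}. \<not> squarefree (k * fact y + 1)}"
  let ?T = "\<lambda>d. {k\<in>{1..K}. d ^ 2 dvd k * fact y + 1}"
  have "?S \<subseteq> (\<Union>d\<in>{y<..L}. ?T d)"
  proof
    fix k assume k: "k \<in> ?S"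
    then obtain p where p: "p > y" "p ^ 2 dvd k * fact y + 1"
      using prime_square_dvd_fact_progression by blast
    have "k * fact y + 1 \<le> X" using k by (simp add: X_def)
    with dvd_imp_le[OF p(2)] have "p ^ 2 \<le> X" by linarith
    then have "(real p) ^ 2 \<le> real X" by (metis of_nat_le_iff of_nat_power)
    then have "real p \<le> sqrt (real X)" by (simp add: real_le_rsqrt)
    then have "p \<le> L" unfolding L_def by (simp add: le_nat_floor)
    then show "k \<in> (\<Union>d\<in>{y<..L}. ?T d)" using p k by auto
  qed
  then have "card ?S \<le> card (\<Union>d\<in>{y<..L}. ?T d)" by (intro card_mono) auto
  also have "\<dots> \<le> (\<Sum>d\<in>{y<..L}. card (?T d))" by (intro card_UN_le) auto
  finally have "real (card ?S) \<le> real (\<Sum>d\<in>{y<..L}. card (?T d))"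
    by (simp only: of_nat_le_iff)
  also have "\<dots> = (\<Sum>d\<in>{y<..L}. real (card (?T d)))" by simp
  also have "\<dots> \<le> (\<Sum>d\<in>{y<..L}. real K * (1 / real d ^ 2) + 1)"
  proof (rule sum_mono)
    fix d assume d: "d \<in> {y<..L}"
    then have "card (?T d) \<le> K div d ^ 2 + 1" by (intro card_dvd_progression) simp
    then have "real (card (?T d)) \<le> real (K div d ^ 2) + 1" by linarith
    also have "real (K div d ^ 2) \<le> real K / real (d ^ 2)"
    proof -
      have "real (K div d ^ 2 * d ^ 2) \<le> real K" by (simp only: of_nat_le_iff div_times_less_eq_dividend)
      then show ?thesis using d by (simp add: pos_le_divide_eq)
    qed
    finally show "real (card (?T d)) \<le> real K * (1 / real d ^ 2) + 1" by simp
  qed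
  also have "\<dots> = real K * (\<Sum>d\<in>{y<..L}. 1 / real d ^ 2) + real (L - y)"
    by (simp add: sum.distrib sum_distrib_left)
  also have "\<dots> \<le> real K * (1 / real y) + sqrt (real X)"
  proof (intro add_mono mult_left_mono sum_inverse_squares_tail assms)
    have "real (L - y) \<le> real L" by simp
    also have "\<dots> \<le> sqrt (real X)" unfolding L_def by simp
    finally show "real (L - y) \<le> sqrt (real X)" .
  qed simp
  finally show ?thesis by (simp add: X_def)
qed

section \<open>Sets with property P have density zero\<close>

text \<open>What matters is that \<open>C\<close> does not depend on \<open>x\<close>: it counts the
  finitely many exceptional elements of \<open>A\<close>, which depend on \<open>y\<close>
  alone.\<close>

lemma property_P_card_bound:
  fixes A :: "nat set" and y :: nat
  assumes P: "property_P A" and y: "y \<ge> 1"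
  obtains C :: real where "\<And>x. x \<ge> 0 \<Longrightarrow> real (card (A \<inter> initial_segment x))
    \<le> C + (x + fact y) / real y + fact y * sqrt (x + fact y + 1)"
proof
  define W :: nat where "W = fact y"
  \<comment> \<open>The exceptional elements: some shift by at most \<open>W + 1\<close> makes them
    squarefree. Property P for each single shift makes \<open>F\<close> finite.\<close>
  define F where "F = (\<Union>n\<in>{1..W + 1}. {a\<in>A. n + a \<in> SF})"
  have W: "W > 0" by (simp add: W_def)
  have "finite F" using P by (auto simp: F_def property_P_def)
  fix x :: real assume x: "x \<ge> 0"
  define K where "K = nat \<lfloor>x\<rfloor> div W + 1"
  let ?B = "{k\<in>{1..K}. \<not> squarefree (k * W + 1)}"
  let ?S = "A \<inter> initial_segment x"
  \<comment> \<open>The first component is the index \<open>k\<close> of a term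
    \<open>k * W + 1\<close> lying between 2 and \<open>W + 1\<close> above \<open>a\<close>. For
    \<open>a\<close> outside \<open>F\<close> this term is not squarefree, and the remainder
    \<open>a mod W\<close> separates the at most \<open>W\<close> elements sharing the same
    \<open>k\<close>.\<close>
  let ?h = "\<lambda>a. (a div W + 1, a mod W)"
  have "?h ` (?S - F) \<subseteq> ?B \<times> {..<W}"
  proof (clarsimp simp: W, intro conjI notI)
    fix a assume a: "a \<in> A" "a \<in> initial_segment x" "a \<notin> F"
    then have "a \<le> nat \<lfloor>x\<rfloor>" by (auto simp: initial_segment_def le_nat_floor)
    then show "Suc (a div W) \<le> K" by (simp add: K_def div_le_mono)
    define n where "n = W + 1 - a mod W"
    have "a mod W < W" using W by simp
    then have n: "n \<in> {1..W + 1}" by (auto simp: n_def)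
    have "n + a = W + 1 + a div W * W"
      using \<open>a mod W < W\<close> div_mult_mod_eq[of a W] unfolding n_def by linarith
    moreover assume "squarefree (Suc (W + a div W * W))"
    ultimately have "n + a \<in> SF" by (simp add: SF_def)
    with a n show False by (auto simp: F_def)
  qed
  moreover have "inj_on ?h (?S - F)"
    by (rule inj_onI) (metis Pair_inject add_right_cancel div_mult_mod_eq)
  ultimately have "card (?S - F) \<le> card (?B \<times> {..<W})"
    by (intro card_inj_on_le) auto
  then have "card (?S - F) \<le> card ?B * W" by simp
  moreover have "card ?S \<le> card F + card (?S - F)"
  proof -
    have "finite ?S"
      by (rule finite_subset[of _ "{..nat \<lfloor>x\<rfloor>}"]) (auto simp: initial_segment_def le_nat_floor)
    then have "card ?S \<le> card (F \<union> (?S - F))" using \<open>finite F\<close> by (intro card_mono) auto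
    also have "\<dots> \<le> card F + card (?S - F)" by (rule card_Un_le)
    finally show ?thesis .
  qed
  ultimately have "card ?S \<le> card F + card ?B * W" by linarith
  then have "real (card ?S) \<le> real (card F + card ?B * W)" by (simp only: of_nat_le_iff)
  also have "\<dots> = real (card F) + real (card ?B) * real W" by simp
  also have "\<dots> \<le> real (card F) + (real K / real y + sqrt (real (K * W + 1))) * real W"
    using card_nonsquarefree_progression[OF y, of K] by (intro add_mono mult_right_mono) (auto simp: W_def)
  also have "\<dots> = real (card F) + real (K * W) / real y + real W * sqrt (real (K * W) + 1)"
    by (simp add: algebra_simps)
  also have "\<dots> \<le> real (card F) + (x + real W) / real y + real W * sqrt (x + real W + 1)"
  proof -
    have "K * W \<le> nat \<lfloor>x\<rfloor> + W" by (simp add: K_def)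
    then have "real (K * W) \<le> real (nat \<lfloor>x\<rfloor>) + real W" by (metis of_nat_add of_nat_le_iff)
    then have "real (K * W) \<le> x + real W" using x by linarith
    then show ?thesis
      by (intro add_mono mult_left_mono divide_right_mono real_sqrt_le_mono) auto
  qed
  finally show "real (card (A \<inter> initial_segment x))
    \<le> real (card F) + (x + fact y) / real y + fact y * sqrt (x + fact y + 1)"
    by (simp add: W_def)
qed

lemma property_P_density_zero:
  assumes "property_P A"
  shows "has_natural_density A 0"
  unfolding has_natural_density_def
proof (rule order_tendstoI)
  fix e :: real assume "e < 0"
  show "\<forall>\<^sub>F x in at_top. e < real (card (A \<inter> initial_segment x)) / x"
    using eventually_ge_at_top[of "0 :: real"]
  proof eventually_elim
    case (elim x)
    then have "0 \<le> real (card (A \<inter> initial_segment x)) / x" by simp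
    with \<open>e < 0\<close> show ?case by linarith
  qed
next
  fix e :: real assume e: "0 < e"
  obtain y :: nat where y: "y \<ge> 1" "1 / real y < e"
  proof -
    obtain n where "inverse (real (Suc n)) < e" using reals_Archimedean[OF e] by blast
    then show thesis by (intro that[of "Suc n"]) (simp_all add: inverse_eq_divide)
  qed
  obtain C where C: "\<And>x. x \<ge> 0 \<Longrightarrow> real (card (A \<inter> initial_segment x))
      \<le> C + (x + fact y) / real y + fact y * sqrt (x + fact y + 1)"
    using property_P_card_bound[OF assms y(1)] by blast
  \<comment> \<open>After division by \<open>x\<close> the constants and the square root vanish in
    the limit, leaving \<open>1 / v\<close>. The values \<open>real y\<close> and
    \<open>fact y\<close> are abstracted to positive reals \<open>v\<close> and \<open>w\<close> for
    \<open>real_asymp\<close>.\<close>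
  have "((\<lambda>x. (C + (x + w) / v + w * sqrt (x + w + 1)) / x) \<longlongrightarrow> 1 / v) at_top"
    if "v > 0" "w > 0" for v w :: real
    using that unfolding inverse_eq_divide[symmetric] by real_asymp
  from this[of "real y" "fact y"] y(1)
  have "((\<lambda>x. (C + (x + fact y) / real y + fact y * sqrt (x + fact y + 1)) / x) \<longlongrightarrow> 1 / real y) at_top"
    by simp
  from order_tendstoD(2)[OF this y(2)]
  show "\<forall>\<^sub>F x in at_top. real (card (A \<inter> initial_segment x)) / x < e"
    using eventually_gt_at_top[of "0 :: real"]
  proof eventually_elim
    case (elim x)
    then show ?case using C[of x] divide_right_mono[OF C[of x], of x] by linarith
  qed
qed

text \<open>Write \<open>a_j\<close> for \<open>nth_element A j\<close>. At \<open>x = a_j\<close>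
  the counting function is at least \<open>j\<close>, so \<open>j / a_j\<close> tends to 0 from
  above, and its inverse tends to infinity.\<close>

lemma density_zero_nth_element:
  assumes A: "A \<subseteq> {1..}" "infinite A" and dens: "has_natural_density A 0"
  shows "filterlim (\<lambda>j. real (nth_element A j) / real j) at_top sequentially"
proof -
  \<comment> \<open>Used twice: to let \<open>a_j\<close> tend to infinity, and to make
    \<open>j / a_j\<close> positive before inverting.\<close>
  have lb: "j \<le> nth_element A j" if "j \<ge> 1" for j
  proof (cases "enumerate A 0 = 0")
    case True
    then show ?thesis using A enumerate_in_set[OF A(2), of 0] by auto
  next
    case False
    have "i + 1 \<le> enumerate A i" for i
    proof (induction i)
      case (Suc i)
      then show ?case using enumerate_step[OF A(2), of i] by simp
    qed (use False in simp)
    from this[of "j - 1"] that show ?thesis by (simp add: nth_element_def)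
  qed
  have "filterlim (\<lambda>j. real (nth_element A j)) at_top sequentially"
    by (rule filterlim_at_top_mono[OF filterlim_real_sequentially])
      (use lb in \<open>auto simp: eventually_sequentially intro!: exI[of _ 1]\<close>)
  with dens have lim: "(\<lambda>j. real (card (A \<inter> initial_segment (real (nth_element A j))))
      / real (nth_element A j)) \<longlonglongrightarrow> 0"
    unfolding has_natural_density_def by (rule filterlim_compose)
  have count: "j \<le> card (A \<inter> initial_segment (real (nth_element A j)))" if "j \<ge> 1" for j
  proof -
    have "enumerate A ` {..<j} \<subseteq> A \<inter> initial_segment (real (nth_element A j))"
      using A enumerate_in_set[OF A(2)] that
      by (auto simp: initial_segment_def nth_element_def subset_eq)
    moreover have "finite (A \<inter> initial_segment (real (nth_element A j)))"
      by (rule finite_subset[of _ "{..nth_element A j}"]) (auto simp: initial_segment_def)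
    ultimately have "card (enumerate A ` {..<j}) \<le> card (A \<inter> initial_segment (real (nth_element A j)))"
      by (rule card_mono[rotated])
    moreover have "card (enumerate A ` {..<j}) = j"
      using inj_enumerate[OF A(2)] by (simp add: card_image inj_on_subset)
    ultimately show ?thesis by simp
  qed
  have "(\<lambda>j. real j / real (nth_element A j)) \<longlonglongrightarrow> 0"
  proof (rule tendsto_sandwich[OF _ _ tendsto_const lim])
    show "\<forall>\<^sub>F j in sequentially. real j / real (nth_element A j)
        \<le> real (card (A \<inter> initial_segment (real (nth_element A j)))) / real (nth_element A j)"
      using eventually_ge_at_top[of 1] by eventually_elim (use count in \<open>auto intro: divide_right_mono\<close>)
  qed auto
  moreover have "\<forall>\<^sub>F j in sequentially. 0 < real j / real (nth_element A j)"
    using eventually_ge_at_top[of 1]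
  proof eventually_elim
    case (elim j)
    then show ?case using lb[of j] by auto
  qed
  ultimately have "filterlim (\<lambda>j. inverse (real j / real (nth_element A j))) at_top sequentially"
    by (rule filterlim_inverse_at_top)
  then show ?thesis by simp
qed

section \<open>Slowly growing sequences with property P\<close>

text \<open>By the Chinese remainder theorem the conditions define a residue class modulo the
  product of the squares, and such a class meets every window of that length.\<close>

lemma crt_square_window:
  fixes q :: "nat \<Rightarrow> nat" and b :: nat
  assumes q: "\<And>n. prime (q n)" "inj q"
  obtains a where "b < a" "a \<le> b + (\<Prod>n\<in>{1..k}. q n ^ 2)" "\<And>n. n \<in> {1..k} \<Longrightarrow> q n ^ 2 dvd n + a"
proof -
  have pos: "q n > 0" for n using q(1) by (simp add: prime_gt_0_nat)
  have "\<forall>i\<in>{1..k}. \<forall>j\<in>{1..k}. i \<noteq> j \<longrightarrow> coprime (q i ^ 2) (q j ^ 2)"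
    using q by (simp add: primes_coprime inj_eq)
  \<comment> \<open>The prescribed residue is \<open>-(n + b + 1)\<close> modulo
    \<open>q n ^ 2\<close>, written without negative numbers. It makes
    \<open>n + (b + 1 + x)\<close> divisible by \<open>q n ^ 2\<close>.\<close>
  then obtain x where x: "x < (\<Prod>n\<in>{1..k}. q n ^ 2)"
      "\<forall>n\<in>{1..k}. [x = (n + b + 1) * (q n ^ 2 - 1)] (mod q n ^ 2)"
    using chinese_remainder_unique_nat[of "{1..k}" "\<lambda>n. q n ^ 2" "\<lambda>n. (n + b + 1) * (q n ^ 2 - 1)"] pos
    by auto
  show ?thesis
  proof (rule that[of "b + 1 + x"])
    fix n assume "n \<in> {1..k}"
    then have "[(n + b + 1) + x = (n + b + 1) + (n + b + 1) * (q n ^ 2 - 1)] (mod q n ^ 2)"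
      using x(2) by (blast intro: cong_add cong_refl)
    also have "(n + b + 1) + (n + b + 1) * (q n ^ 2 - 1) = (n + b + 1) * (1 + (q n ^ 2 - 1))"
      by (simp only: distrib_left mult_1_right)
    also have "1 + (q n ^ 2 - 1) = q n ^ 2" using pos[of n] by simp
    finally have "q n ^ 2 dvd (n + b + 1) + x" by (simp add: cong_dvd_iff)
    then show "q n ^ 2 dvd n + (b + 1 + x)" by (simp add: add_ac)
  qed (use x(1) in auto)
qed

lemma slow_level_function:
  fixes f M :: "nat \<Rightarrow> nat"
  assumes M0: "M 0 = 1" and f: "\<And>j. j \<ge> 1 \<Longrightarrow> f j \<ge> 1" "filterlim f at_top sequentially"
  obtains g :: "nat \<Rightarrow> nat" where "\<And>i j. 1 \<le> j \<Longrightarrow> j \<le> i \<Longrightarrow> M (g j) \<le> f i"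
    "filterlim g at_top sequentially"
proof -
  \<comment> \<open>The bound \<open>k \<le> j\<close> ensures that a greatest \<open>k\<close>
    exists, and \<open>M 0 = 1\<close> makes \<open>k = 0\<close> admissible. Quantifying over all
    \<open>i \<ge> j\<close> copes with \<open>f\<close> that are not monotone.\<close>
  define P where "P = (\<lambda>j k. k \<le> j \<and> (\<forall>i\<ge>j. M k \<le> f i))"
  define g where "g = (\<lambda>j. GREATEST k. P j k)"
  have "P j (g j)" if "j \<ge> 1" for j
    unfolding g_def
  proof (rule GreatestI_nat)
    show "P j 0" using M0 f(1) that by (simp add: P_def)
    show "\<And>k. P j k \<Longrightarrow> k \<le> j" by (simp add: P_def)
  qed
  moreover have "filterlim g at_top sequentially"
    unfolding filterlim_at_top
  proof
    fix k
    obtain J where J: "\<And>i. i \<ge> J \<Longrightarrow> M k \<le> f i"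
      using f(2) unfolding filterlim_at_top eventually_sequentially by blast
    have "k \<le> g j" if "j \<ge> max k J" for j
      unfolding g_def
    proof (rule Greatest_le_nat)
      show "P j k" using J that by (simp add: P_def)
      show "\<And>k. P j k \<Longrightarrow> k \<le> j" by (simp add: P_def)
    qed
    then show "\<forall>\<^sub>F j in sequentially. k \<le> g j"
      unfolding eventually_sequentially by blast
  qed
  ultimately show ?thesis by (intro that[of g]) (auto simp: P_def)
qed

text \<open>Transfers bounds on an explicitly constructed sequence to \<open>nth_element\<close> of
  its range.\<close>

lemma enumerate_range_strict_mono:
  fixes s :: "nat \<Rightarrow> nat"
  assumes "strict_mono s"
  shows "enumerate (range s) = s"
proof -
  have inf: "infinite (range s)"
    using assms by (simp add: range_inj_infinite strict_mono_imp_inj_on)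
  have "enumerate (range s) n \<le> s n" for n
  proof (induction n)
    case 0
    show ?case unfolding enumerate_0 by (rule Least_le) simp
  next
    case (Suc n)
    have "s n < s (Suc n)" using assms by (simp add: strict_mono_def)
    with Suc have "enumerate (range s) n < s (Suc n)" by simp
    then show ?case unfolding enumerate_Suc''[OF inf] by (intro Least_le) simp
  qed
  moreover have "s n \<le> enumerate (range s) n" for n
  proof (induction n)
    case 0
    obtain m where "enumerate (range s) 0 = s m" using enumerate_in_set[OF inf] by blast
    then show ?case using assms by (simp add: strict_mono_less_eq)
  next
    case (Suc n)
    obtain m where m: "enumerate (range s) (Suc n) = s m" using enumerate_in_set[OF inf] by blast
    then have "s n < s m" using Suc enumerate_step[OF inf, of n] by simp
    then have "Suc n \<le> m" using assms by (simp add: strict_mono_less)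
    then show ?case using assms m by (simp add: strict_mono_less_eq)
  qed
  ultimately show ?thesis by (intro ext antisym)
qed

lemma property_P_slow_sequence:
  fixes f :: "nat \<Rightarrow> nat"
  assumes f: "\<And>j. j \<ge> 1 \<Longrightarrow> f j \<ge> 1" "filterlim f at_top sequentially"
  obtains A where "A \<subseteq> {1..}" "infinite A" "property_P A"
    "\<And>j. j \<ge> 1 \<Longrightarrow> real (nth_element A j) / real j \<le> real (f j)"
proof -
  define q :: "nat \<Rightarrow> nat" where "q = enumerate {p. prime p}"
  have q: "\<And>n. prime (q n)" "inj q"
    using enumerate_in_set[OF primes_infinite] inj_enumerate[OF primes_infinite] by (auto simp: q_def)
  define M where "M = (\<lambda>k. \<Prod>n\<in>{1..k}. q n ^ 2)"
  obtain g where g: "\<And>i j. 1 \<le> j \<Longrightarrow> j \<le> i \<Longrightarrow> M (g j) \<le> f i" "filterlim g at_top sequentially"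
    using slow_level_function[of M f] f by (auto simp: M_def)
  \<comment> \<open>The value \<open>a 0 = 0\<close> only starts the recursion; the elements of the
    set are \<open>a 1\<close>, \<open>a 2\<close> and so on. Each is taken in the window of length
    \<open>M (g (Suc j))\<close> above its predecessor.\<close>
  have "\<exists>a. \<forall>j. (j = 0 \<longrightarrow> a j = 0) \<and> (a j < a (Suc j) \<and> a (Suc j) \<le> a j + M (g (Suc j))
      \<and> (\<forall>n\<in>{1..g (Suc j)}. q n ^ 2 dvd n + a (Suc j)))"
  proof (rule dependent_nat_choice)
    fix b j
    show "\<exists>c. (Suc j = 0 \<longrightarrow> c = 0) \<and> (b < c \<and> c \<le> b + M (g (Suc j))
      \<and> (\<forall>n\<in>{1..g (Suc j)}. q n ^ 2 dvd n + c))"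
      using crt_square_window[OF q, of b "g (Suc j)"] unfolding M_def by (metis nat.simps(3))
  qed simp
  then obtain a where a: "a 0 = 0" "\<And>j. a j < a (Suc j)" "\<And>j. a (Suc j) \<le> a j + M (g (Suc j))"
    "\<And>j n. n \<in> {1..g (Suc j)} \<Longrightarrow> q n ^ 2 dvd n + a (Suc j)" by metis
  define s where "s = (\<lambda>j. a (Suc j))"
  have mono: "strict_mono s" unfolding s_def by (rule strict_mono_Suc_iff[THEN iffD2]) (use a(2) in blast)
  show ?thesis
  proof (rule that[of "range s"])
    show "range s \<subseteq> {1..}"
    proof
      fix x assume "x \<in> range s"
      then obtain j where "x = a (Suc j)" by (auto simp: s_def)
      then show "x \<in> {1..}" using a(2)[of j] by simp
    qed
    show "infinite (range s)"
      using mono by (simp add: range_inj_infinite strict_mono_imp_inj_on)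
    show "property_P (range s)"
      unfolding property_P_def
    proof (intro allI impI)
      fix n :: nat assume n: "1 \<le> n"
      obtain J where J: "\<And>j. j \<ge> J \<Longrightarrow> n \<le> g j"
        using g(2) unfolding filterlim_at_top eventually_sequentially by blast
      \<comment> \<open>As soon as \<open>g\<close> has reached \<open>n\<close>, every later term
        is chosen with \<open>q n ^ 2 dvd n + s j\<close>, so only earlier terms can give a
        squarefree sum.\<close>
      have "{x \<in> range s. n + x \<in> SF} \<subseteq> s ` {..<J}"
      proof clarify
        fix j assume sf: "n + s j \<in> SF"
        have "j < J"
        proof (rule ccontr)
          assume "\<not> j < J"
          then have "n \<in> {1..g (Suc j)}" using J[of "Suc j"] n by simp
          then have "q n ^ 2 dvd n + s j" using a(4) by (simp add: s_def)
          moreover have "\<not> q n dvd 1" using q(1)[of n] by auto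
          ultimately show False using sf squarefreeD[of "n + s j" "q n"] by (simp add: SF_def)
        qed
        then show "s j \<in> s ` {..<J}" by simp
      qed
      then show "finite {x \<in> range s. n + x \<in> SF}" by (rule finite_subset) simp
    qed
    fix j :: nat assume j: "j \<ge> 1"
    \<comment> \<open>With \<open>j\<close> fixed, each of the first \<open>j\<close> gaps is at
      most \<open>f j\<close>, by the choice of \<open>g\<close>.\<close>
    have "a i \<le> i * f j" if "i \<le> j" for i
      using that
    proof (induction i)
      case (Suc i)
      then show ?case using a(3)[of i] g(1)[of "Suc i" j] by simp
    qed (simp add: a(1))
    then have "a j \<le> j * f j" by simp
    moreover have "nth_element (range s) j = a j"
      using j by (simp add: nth_element_def enumerate_range_strict_mono[OF mono]) (simp add: s_def)
    ultimately have "real (nth_element (range s) j) \<le> real j * real (f j)"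
      by (metis of_nat_le_iff of_nat_mult)
    then show "real (nth_element (range s) j) / real j \<le> real (f j)"
      using j by (simp add: divide_le_eq mult.commute)
  qed
qed

text \<open>The condition \<open>f j \<ge> 1\<close> for \<open>j \<ge> 1\<close> expresses that
  \<open>f\<close> takes values in the positive integers.\<close>

theorem theorem1p2:
  "(\<forall>A::nat set. A \<subseteq> {1..} \<and> property_P A \<longrightarrow>
      has_natural_density A 0 \<and>
      (infinite A \<longrightarrow>
        filterlim (\<lambda>j. real (nth_element A j) / real j) at_top sequentially))
   \<and>
   (\<forall>f::nat \<Rightarrow> nat. (\<forall>j\<ge>1. f j \<ge> 1) \<and> filterlim f at_top sequentially \<longrightarrow>
      (\<exists>A::nat set. A \<subseteq> {1..} \<and> infinite A \<and> property_P A \<and>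
        (\<forall>j\<ge>1. real (nth_element A j) / real j \<le> real (f j))))"
proof (intro conjI allI impI; (elim conjE)?)
  fix A :: "nat set" assume A: "A \<subseteq> {1..}" "property_P A"
  show dens: "has_natural_density A 0" using A(2) by (rule property_P_density_zero)
  show "filterlim (\<lambda>j. real (nth_element A j) / real j) at_top sequentially" if "infinite A"
    using A(1) that dens by (rule density_zero_nth_element)
next
  fix f :: "nat \<Rightarrow> nat" assume "\<forall>j\<ge>1. f j \<ge> 1" "filterlim f at_top sequentially"
  then show "\<exists>A. A \<subseteq> {1..} \<and> infinite A \<and> property_P A \<and>
        (\<forall>j\<ge>1. real (nth_element A j) / real j \<le> real (f j))"
    using property_P_slow_sequence[of f] by metis
qed

end
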